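(* Consider the system described in the context with infinite battery capacity, mean harvested energy per slot $\bar A>0$, and $p_c\in(0,1]$. Define $$C_{\mathrm{thr,PO}}=\min\Big\{N,\Big\lfloor \frac{(N+p_c)\bar A}{p_cE_p}\Big\rfloor\Big\}.$$ Under the push-only threshold-based (POTB) policy, the SBS acts as follows in slot $k$: - if $C_k<C_{\mathrm{thr,PO}}$ and $E_k\ge E_p$, it pushes; - otherwise it sleeps (it never unicasts). Then the blocking probability equals $$p_{\mathrm{blk,PO}}=p_u\Big(1-\sum_{i=1}^{C_{\mathrm{thr,PO}}}f_i\Big).$$
   Context: Time is slotted. There are $N$ contents ranked $c_1,\dots,c_N$, and rank $i$ has popularity $f_i=\frac{i^{-v}}{\sum_{j=1}^N j^{-v}}$ with $v\ge0$. Popularity dynamics: in each slot, with probability $p_c$, a uniformly chosen content is removed; the contents below it move up one rank, and a new content enters at rank $N$. Push state and actions: users store $c_1,\dots,c_{C_k}$ ($C_k\in\{0,\dots,N\}$). In each slot the SBS chooses sleep (cost $0$), unicast (cost $E_u(d)$, where $d$ is the requester's distance) or push (cost $E_p$, sends $c_{C_k+1}$ to all users). The energy used must not exceed the battery level $E_k$. Transitions of $C_k$: - without push: $C_{k+1}=C_k-1$ with probability $p_cC_k/N$, else $C_k$; - with push: $C_{k+1}=C_k$ with probability $p_cC_k/N$, else $C_k+1$. Requests: each slot, independently, with probability $p_u$ there is a request, for $c_i$ with probability $f_i$, at a location uniform in a disk of radius $R$. A request is blocked if its content has rank $>C_k$ and it is neither unicast nor pushed in that slot. The blocking probability is the long-run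 fraction of slots with a blocked request. Energy: the battery evolves as $E_{k+1}=E_k-U_k+A_k$ (infinite capacity), where $U_k$ is the energy used in slot $k$ and the harvested energies $A_k$ are i.i.d. with mean $\bar A$. *)

theory Defs
  imports "HOL-Probability.Probability"
begin

definition zipf :: "nat \<Rightarrow> real \<Rightarrow> nat \<Rightarrow> real" where
  "zipf N v i = (if i \<in> {1..N} then real i powr (- v) / (\<Sum>j=1..N. real j powr (- v)) else 0)"

lemma zipf_nonneg: "zipf N v i \<ge> 0"
  unfolding zipf_def by (auto intro!: divide_nonneg_nonneg sum_nonneg)

lemma zipf_sum: assumes "N \<ge> 1" shows "(\<Sum>i=1..N. zipf N v i) = 1"
proof -
  have pos: "(\<Sum>j=1..N. real j powr (- v)) > 0"
    using assms by (intro sum_pos) auto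
  have "(\<Sum>i=1..N. zipf N v i) = (\<Sum>i=1..N. real i powr (- v)) / (\<Sum>j=1..N. real j powr (- v))"
    unfolding zipf_def sum_divide_distrib by (intro sum.cong) auto
  also have "\<dots> = 1" using pos by simp
  finally show ?thesis .
qed

definition zipf_pmf :: "nat \<Rightarrow> real \<Rightarrow> nat pmf" where
  "zipf_pmf N v = embed_pmf (zipf N v)"

lemma pmf_zipf_pmf:
  assumes "N \<ge> 1" shows "pmf (zipf_pmf N v) i = zipf N v i"
proof -
  have "(\<integral>\<^sup>+ x. ennreal (zipf N v x) \<partial>count_space UNIV)
        = (\<integral>\<^sup>+ x. ennreal (zipf N v x) * indicator {1..N} x \<partial>count_space UNIV)"
    by (intro nn_integral_cong) (auto simp: zipf_def indicator_def)
  also have "\<dots> = (\<Sum>x\<in>{1..N}. ennreal (zipf N v x))"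
    by (subst nn_integral_count_space_indicator[symmetric]) (auto simp: nn_integral_count_space_finite)
  also have "\<dots> = ennreal (\<Sum>x\<in>{1..N}. zipf N v x)"
    by (intro sum_ennreal) (simp add: zipf_nonneg)
  also have "\<dots> = 1" using zipf_sum[OF assms] by simp
  finally show ?thesis unfolding zipf_pmf_def
    by (intro pmf_embed_pmf) (auto simp: zipf_nonneg)
qed

definition request_pmf :: "real \<Rightarrow> nat \<Rightarrow> real \<Rightarrow> nat option pmf" where
  "request_pmf pu N v =
     do { b \<leftarrow> bernoulli_pmf pu; if b then map_pmf Some (zipf_pmf N v) else return_pmf None }"

text \<open>Discrete part of a slot: (removal occurs?, removed rank uniform on 1..N, request).\<close>
definition disc_pmf :: "real \<Rightarrow> real \<Rightarrow> nat \<Rightarrow> real \<Rightarrow> (bool \<times> nat \<times> nat option) pmf" where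
  "disc_pmf pc pu N v = pair_pmf (bernoulli_pmf pc) (pair_pmf (pmf_of_set {1..N}) (request_pmf pu N v))"

type_synonym slot = "(bool \<times> nat \<times> nat option) \<times> real"

text \<open>Distribution of one slot: discrete part independent of harvested energy (law H).\<close>
definition slot_measure :: "real \<Rightarrow> real \<Rightarrow> nat \<Rightarrow> real \<Rightarrow> real measure \<Rightarrow> slot measure" where
  "slot_measure pc pu N v H = measure_pmf (disc_pmf pc pu N v) \<Otimes>\<^sub>M H"

definition slots_measure :: "real \<Rightarrow> real \<Rightarrow> nat \<Rightarrow> real \<Rightarrow> real measure \<Rightarrow> (nat \<Rightarrow> slot) measure" where
  "slots_measure pc pu N v H = (\<Pi>\<^sub>M k\<in>(UNIV::nat set). slot_measure pc pu N v H)"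

definition C_thr_PO :: "nat \<Rightarrow> real \<Rightarrow> real \<Rightarrow> real \<Rightarrow> nat" where
  "C_thr_PO N pc Abar Ep = min N (nat \<lfloor>(real N + pc) * Abar / (pc * Ep)\<rfloor>)"

definition potb_push :: "nat \<Rightarrow> real \<Rightarrow> nat \<Rightarrow> real \<Rightarrow> bool" where
  "potb_push Cthr Ep C E = (C < Cthr \<and> E \<ge> Ep)"

text \<open>State (C_k, E_k) in slot k, starting at (C0, E0), driven by the slot randomness w.
  A removal (flag r) of the content of rank j hits the stored set iff j \<le> C_k, which has
  probability p_c C_k / N, giving exactly the transition law of C_k in the model.\<close>
fun potb_state :: "nat \<Rightarrow> real \<Rightarrow> nat \<Rightarrow> real \<Rightarrow> (nat \<Rightarrow> slot) \<Rightarrow> nat \<Rightarrow> nat \<times> real" where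
  "potb_state Cthr Ep C0 E0 w 0 = (C0, E0)"
| "potb_state Cthr Ep C0 E0 w (Suc k) =
     (let (C, E) = potb_state Cthr Ep C0 E0 w k;
          ((r, j, q), a) = w k;
          push = potb_push Cthr Ep C E;
          hit = (r \<and> j \<le> C)
      in (if push then (if hit then C else C + 1) else (if hit then C - 1 else C),
          E - (if push then Ep else 0) + a))"

text \<open>Slot k has a blocked request: a request for rank i > C_k that is not served by the push
  (POTB never unicasts; a push in the slot delivers the content of rank C_k + 1).\<close>
definition potb_blocked :: "nat \<Rightarrow> real \<Rightarrow> nat \<Rightarrow> real \<Rightarrow> (nat \<Rightarrow> slot) \<Rightarrow> nat \<Rightarrow> bool" where
  "potb_blocked Cthr Ep C0 E0 w k =
     (let (C, E) = potb_state Cthr Ep C0 E0 w k;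
          ((r, j, q), a) = w k
      in (case q of None \<Rightarrow> False
          | Some i \<Rightarrow> C < i \<and> \<not> (potb_push Cthr Ep C E \<and> i = C + 1)))"

definition blocked_fraction :: "nat \<Rightarrow> real \<Rightarrow> nat \<Rightarrow> real \<Rightarrow> (nat \<Rightarrow> slot) \<Rightarrow> nat \<Rightarrow> real" where
  "blocked_fraction Cthr Ep C0 E0 w n =
     (\<Sum>k<n. if potb_blocked Cthr Ep C0 E0 w k then 1 else 0) / real n"

end

theory Submission
  imports Defs "HOL-Library.Discrete_Functions"
begin

text \<open>
  Let \<open>T\<close> be the threshold. In a slot with \<open>C\<^sub>k = T\<close>, or with \<open>C\<^sub>k = T - 1\<close> and a push, exactly the
  requests of rank above \<open>T\<close> are blocked, so by the strong law for the requests it suffices that all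
  other slots have density zero almost surely.

  Pushes and hits balance up to a bounded error, and by a strong law for predictably selected slots
  the number of hits up to time \<open>n\<close> is \<open>(p\<^sub>c / N) \<Sum>\<^sub>k C\<^sub>k + o(n)\<close>. Write \<open>\<pi>\<close> and \<open>\<sigma>\<close> for the fractions of
  pushes and of starved slots (\<open>C\<^sub>k < T\<close> but too little energy). As \<open>C\<^sub>k \<le> T\<close> outside density zero and
  \<open>C\<^sub>k \<le> T - 1\<close> in pushing and starved slots, \<open>(N / p\<^sub>c) \<pi> \<le> T - \<pi> - \<sigma> + o(1)\<close>, that is,
  \<open>\<sigma> \<le> T - (1 + N / p\<^sub>c) \<pi> + o(1)\<close>. At a starved slot the battery is below \<open>E\<^sub>p\<close>, so almost all
  harvested energy has been spent and \<open>\<pi> \<ge> A / E\<^sub>p - o(1)\<close> for the mean harvest \<open>A\<close>; the choice of \<open>T\<close>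
  then gives \<open>\<sigma> \<le> o(1)\<close>. The count of starved slots grows only at starved slots, so it is \<open>o(n)\<close>
  throughout, also in the critical case where consumption equals harvest. Finally the deficit
  \<open>T - C\<^sub>k\<close> rises above one only in starved slots, whereas a push lowers it with probability bounded
  away from zero, so deficits above one have density zero too.
\<close>

section \<open>A strong law for bounded predictable sums\<close>

text \<open>Between \<open>m\<^sup>2\<close> and the next square there are at most
  \<open>2 * m\<close> further times, so bounded increments change the sum by \<open>O(m)\<close>,
  which is negligible after division by \<open>m\<^sup>2\<close>.\<close>

lemma averages_tendsto_zero_of_squares:
  fixes S :: "nat \<Rightarrow> real"
  assumes sq: "(\<lambda>m. S (m\<^sup>2) / real (m\<^sup>2)) \<longlonglongrightarrow> 0"
    and step: "\<And>n. \<bar>S (Suc n) - S n\<bar> \<le> B"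
  shows "(\<lambda>n. S n / real n) \<longlonglongrightarrow> 0"
proof -
  have B: "0 \<le> B" using step[of 0] by linarith
  have lip: "\<bar>S (m + d) - S m\<bar> \<le> B * real d" for m d
  proof (induction d)
    case (Suc d)
    then show ?case using step[of "m + d"] by (simp add: algebra_simps abs_le_iff)
  qed simp
  have flim: "filterlim floor_sqrt at_top sequentially"
    unfolding filterlim_at_top
  proof
    fix Z :: nat
    show "\<forall>\<^sub>F x in sequentially. Z \<le> floor_sqrt x"
      using eventually_ge_at_top[of "Z\<^sup>2"] by eventually_elim (simp add: le_floor_sqrt_iff)
  qed
  have sq': "(\<lambda>m. \<bar>S (m\<^sup>2) / real (m\<^sup>2)\<bar> + 2 * B / real m) \<longlonglongrightarrow> 0 + 0"
    by (intro tendsto_add tendsto_rabs_zero sq lim_const_over_n)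
  have lim: "(\<lambda>n. \<bar>S ((floor_sqrt n)\<^sup>2) / real ((floor_sqrt n)\<^sup>2)\<bar> + 2 * B / real (floor_sqrt n)) \<longlonglongrightarrow> 0"
    using filterlim_compose[OF sq' flim] by simp
  have "\<forall>\<^sub>F n in sequentially. \<bar>S n / real n\<bar>
      \<le> \<bar>S ((floor_sqrt n)\<^sup>2) / real ((floor_sqrt n)\<^sup>2)\<bar> + 2 * B / real (floor_sqrt n)"
    using eventually_gt_at_top[of 0]
  proof eventually_elim
    fix n :: nat assume n: "0 < n"
    define m where "m = floor_sqrt n"
    have m: "0 < m" "m\<^sup>2 \<le> n" using n by (auto simp: m_def)
    have "n < (Suc m)\<^sup>2" unfolding m_def by (rule Suc_floor_sqrt_power2_gt)
    then have d: "n - m\<^sup>2 \<le> 2 * m" by (simp add: power2_eq_square)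
    have "\<bar>S n - S (m\<^sup>2)\<bar> \<le> B * real (n - m\<^sup>2)"
      using lip[of "m\<^sup>2" "n - m\<^sup>2"] m by simp
    also have "\<dots> \<le> B * (2 * real m)"
      using d B by (intro mult_left_mono) linarith+
    finally have "\<bar>S n\<bar> \<le> \<bar>S (m\<^sup>2)\<bar> + B * (2 * real m)" by linarith
    then have "\<bar>S n\<bar> / real n \<le> (\<bar>S (m\<^sup>2)\<bar> + B * (2 * real m)) / real n"
      by (intro divide_right_mono) auto
    also have "\<dots> \<le> (\<bar>S (m\<^sup>2)\<bar> + B * (2 * real m)) / real (m\<^sup>2)"
      using m n B by (intro divide_left_mono) (auto simp del: of_nat_power)
    also have "\<dots> = \<bar>S (m\<^sup>2) / real (m\<^sup>2)\<bar> + 2 * B / real m"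
      using m by (simp add: add_divide_distrib power2_eq_square)
    finally show "\<bar>S n / real n\<bar> \<le> \<bar>S ((floor_sqrt n)\<^sup>2) / real ((floor_sqrt n)\<^sup>2)\<bar> + 2 * B / real (floor_sqrt n)"
      by (simp add: m_def)
  qed
  then have "(\<lambda>n. \<bar>S n / real n\<bar>) \<longlonglongrightarrow> 0"
    by (intro tendsto_sandwich[OF _ _ tendsto_const lim]) auto
  then show ?thesis by (rule tendsto_rabs_zero_cancel)
qed

text \<open>Orthogonality makes the second moment of the sum grow at most linearly. Along the times
  \<open>m\<^sup>2\<close> the averages thus have second moments at most
  \<open>B\<^sup>2 / m\<^sup>2\<close>, a summable bound, which gives almost sure convergence along
  the squares; boundedness fills the gaps.\<close>

lemma (in prob_space) strong_law_bounded_uncorrelated: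
  fixes Y :: "nat \<Rightarrow> 'a \<Rightarrow> real"
  assumes meas [measurable]: "\<And>k. Y k \<in> borel_measurable M"
    and bound: "\<And>k w. w \<in> space M \<Longrightarrow> \<bar>Y k w\<bar> \<le> B"
    and uncorrelated: "\<And>i j. i < j \<Longrightarrow> expectation (\<lambda>w. Y i w * Y j w) = 0"
  shows "AE w in M. (\<lambda>n. (\<Sum>k<n. Y k w) / real n) \<longlonglongrightarrow> 0"
proof -
  define S where "S n w = (\<Sum>k<n. Y k w)" for n w
  have S_meas [measurable]: "S n \<in> borel_measurable M" for n unfolding S_def by measurable
  have S_bound: "\<bar>S n w\<bar> \<le> real n * B" if "w \<in> space M" for n w
    unfolding S_def using bound[OF that] sum_norm_bound[of "{..<n}" "\<lambda>k. Y k w" B] by simp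
  have intg: "integrable M f" if [measurable]: "f \<in> borel_measurable M"
    and "\<And>w. w \<in> space M \<Longrightarrow> \<bar>f w\<bar> \<le> D" for f :: "'a \<Rightarrow> real" and D
    by (rule integrable_const_bound[of _ D]) (use that in auto)
  have int_YY: "integrable M (\<lambda>w. Y i w * Y j w)" for i j
  proof (rule intg)
    fix w assume "w \<in> space M"
    then show "\<bar>Y i w * Y j w\<bar> \<le> B * B"
      unfolding abs_mult using bound by (intro mult_mono) (auto intro: order_trans[OF abs_ge_zero])
  qed measurable
  have int_SS: "integrable M (\<lambda>w. (S n w)\<^sup>2)" for n
  proof (rule intg)
    fix w assume "w \<in> space M"
    then have "\<bar>S n w\<bar>\<^sup>2 \<le> (real n * B)\<^sup>2" by (intro power_mono S_bound) auto
    then show "\<bar>(S n w)\<^sup>2\<bar> \<le> (real n * B)\<^sup>2" by simp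
  qed measurable
  have second_moment: "expectation (\<lambda>w. (S n w)\<^sup>2) \<le> real n * B\<^sup>2" for n
  proof (induction n)
    case 0
    then show ?case by (simp add: S_def)
  next
    case (Suc n)
    have eq: "(S (Suc n) w)\<^sup>2 = (S n w)\<^sup>2 + 2 * (\<Sum>k<n. Y k w * Y n w) + Y n w * Y n w" for w
      by (simp add: S_def power2_sum power2_eq_square algebra_simps sum_distrib_left)
    have "expectation (\<lambda>w. \<Sum>k<n. Y k w * Y n w) = (\<Sum>k<n. expectation (\<lambda>w. Y k w * Y n w))"
      using int_YY by (intro Bochner_Integration.integral_sum) auto
    also have "\<dots> = 0" by (simp add: uncorrelated)
    finally have cross: "expectation (\<lambda>w. \<Sum>k<n. Y k w * Y n w) = 0" .
    have "expectation (\<lambda>w. Y n w * Y n w) \<le> expectation (\<lambda>w. B\<^sup>2)"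
    proof (rule integral_mono[OF int_YY])
      fix w assume "w \<in> space M"
      then have "\<bar>Y n w\<bar>\<^sup>2 \<le> B\<^sup>2" by (intro power_mono bound) auto
      then show "Y n w * Y n w \<le> B\<^sup>2" by (simp add: power2_eq_square)
    qed auto
    then have sq: "expectation (\<lambda>w. Y n w * Y n w) \<le> B\<^sup>2" by (simp add: prob_space)
    have "expectation (\<lambda>w. (S (Suc n) w)\<^sup>2) =
        expectation (\<lambda>w. (S n w)\<^sup>2) + 2 * expectation (\<lambda>w. \<Sum>k<n. Y k w * Y n w)
          + expectation (\<lambda>w. Y n w * Y n w)"
      unfolding eq using int_SS int_YY by simp
    then show ?case using Suc sq cross by (simp add: algebra_simps)
  qed
  define Z where "Z m w = (S (m\<^sup>2) w / real (m\<^sup>2))\<^sup>2" for m w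
  have Z_meas [measurable]: "Z m \<in> borel_measurable M" for m unfolding Z_def by measurable
  have Z_nonneg: "0 \<le> Z m w" for m w by (simp add: Z_def)
  have Z_int: "(\<integral>\<^sup>+w. ennreal (Z m w) \<partial>M) \<le> ennreal (B\<^sup>2 * inverse ((real m)\<^sup>2))" for m
  \<comment> \<open>At \<open>m = 0\<close> both sides are 0, because division by 0 and the inverse
    of 0 are 0.\<close>
  proof (cases "m = 0")
    case False
    have int: "integrable M (Z m)" unfolding Z_def power_divide using int_SS by auto
    have "expectation (Z m) = expectation (\<lambda>w. (S (m\<^sup>2) w)\<^sup>2) / (real (m\<^sup>2))\<^sup>2"
      unfolding Z_def power_divide by simp
    also have "\<dots> \<le> real (m\<^sup>2) * B\<^sup>2 / (real (m\<^sup>2))\<^sup>2"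
      by (intro divide_right_mono second_moment) auto
    also have "\<dots> = B\<^sup>2 * inverse ((real m)\<^sup>2)"
      using False by (simp add: field_simps power2_eq_square)
    finally show ?thesis
      using int Z_nonneg by (subst nn_integral_eq_integral) (auto intro!: ennreal_leI)
  qed (simp add: Z_def)
  have summ: "summable (\<lambda>m. B\<^sup>2 * inverse ((real m)\<^sup>2))"
    using inverse_power_summable[of 2, where 'a=real] by (intro summable_mult) simp
  have "(\<integral>\<^sup>+w. (\<Sum>m. ennreal (Z m w)) \<partial>M) = (\<Sum>m. \<integral>\<^sup>+w. ennreal (Z m w) \<partial>M)"
    by (intro nn_integral_suminf) measurable
  also have "\<dots> \<le> (\<Sum>m. ennreal (B\<^sup>2 * inverse ((real m)\<^sup>2)))"
    by (intro suminf_le Z_int) auto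
  also have "\<dots> < \<infinity>"
    using summ by (subst suminf_ennreal2) auto
  finally have "AE w in M. (\<Sum>m. ennreal (Z m w)) \<noteq> \<infinity>"
    by (intro nn_integral_noteq_infinite) auto
  then show ?thesis
  proof (rule AE_mp, intro AE_I2 impI)
    fix w assume w: "w \<in> space M" and fin: "(\<Sum>m. ennreal (Z m w)) \<noteq> \<infinity>"
    have "summable (\<lambda>m. Z m w)"
      using fin Z_nonneg by (intro summable_suminf_not_top) auto
    then have "(\<lambda>m. Z m w) \<longlonglongrightarrow> 0" by (rule summable_LIMSEQ_zero)
    then have "(\<lambda>m. sqrt (Z m w)) \<longlonglongrightarrow> sqrt 0" by (rule tendsto_real_sqrt)
    then have "(\<lambda>m. \<bar>S (m\<^sup>2) w / real (m\<^sup>2)\<bar>) \<longlonglongrightarrow> 0" by (simp add: Z_def)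
    then have "(\<lambda>m. S (m\<^sup>2) w / real (m\<^sup>2)) \<longlonglongrightarrow> 0" by (rule tendsto_rabs_zero_cancel)
    then have "(\<lambda>n. S n w / real n) \<longlonglongrightarrow> 0"
      by (rule averages_tendsto_zero_of_squares[where B = B]) (simp add: S_def bound[OF w])
    then show "(\<lambda>n. (\<Sum>k<n. Y k w) / real n) \<longlonglongrightarrow> 0" by (simp add: S_def)
  qed
qed

text \<open>Gluing the first \<open>j\<close> coordinates of one sample to an independent second
  sample preserves the product measure. After gluing, \<open>F\<close> sees only the first sample
  and \<xi> only coordinate 0 of the second, so Fubini separates the factors.\<close>

lemma (in sequence_space) integral_predictable_mult_centered:
  fixes F :: "(nat \<Rightarrow> 'a) \<Rightarrow> real" and \<xi> :: "'a \<Rightarrow> real"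
  assumes F [measurable]: "F \<in> borel_measurable S" and F_bound: "\<And>w. w \<in> space S \<Longrightarrow> \<bar>F w\<bar> \<le> B"
    and past: "\<And>w w'. (\<And>i. i < j \<Longrightarrow> w i = w' i) \<Longrightarrow> F w = F w'"
    and \<xi> [measurable]: "\<xi> \<in> borel_measurable M" and \<xi>_bound: "\<And>x. x \<in> space M \<Longrightarrow> \<bar>\<xi> x\<bar> \<le> D"
    and centered: "integral\<^sup>L M \<xi> = 0"
  shows "(\<integral>w. F w * \<xi> (w j) \<partial>S) = 0"
proof -
  interpret SS: pair_prob_space S S ..
  have m1 [measurable]: "(\<lambda>w. \<xi> (w i)) \<in> borel_measurable S" for i by measurable
  have m2: "(\<lambda>p. F (fst p) * \<xi> (snd p 0)) \<in> borel_measurable (S \<Otimes>\<^sub>M S)" by measurable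
  have int: "integrable (S \<Otimes>\<^sub>M S) (\<lambda>p. F (fst p) * \<xi> (snd p 0))"
  proof (rule SS.integrable_const_bound[of _ "B * D"], intro AE_I2)
    fix p assume "p \<in> space (S \<Otimes>\<^sub>M S)"
    then have p: "fst p \<in> space S" "snd p 0 \<in> space M" by (auto simp: space_pair_measure space_PiM)
    then show "norm (F (fst p) * \<xi> (snd p 0)) \<le> B * D"
      unfolding real_norm_def abs_mult using F_bound[OF p(1)] \<xi>_bound[OF p(2)]
      by (intro mult_mono) auto
  qed (fact m2)
  have "(\<integral>w. \<xi> (w 0) \<partial>S) = integral\<^sup>L (distr S M (\<lambda>w. w 0)) \<xi>"
    by (subst integral_distr) auto
  also have "distr S M (\<lambda>w. w 0) = M"
    by (rule PiM_component) auto
  finally have zero: "(\<integral>w. \<xi> (w 0) \<partial>S) = 0" using centered by simp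
  have "(\<integral>w. F w * \<xi> (w j) \<partial>S) = (\<integral>w. F w * \<xi> (w j) \<partial>distr (S \<Otimes>\<^sub>M S) S (\<lambda>(\<omega>, \<omega>'). comb_seq j \<omega> \<omega>'))"
    by (simp only: PiM_comb_seq)
  also have "\<dots> = (\<integral>p. F (comb_seq j (fst p) (snd p)) * \<xi> (comb_seq j (fst p) (snd p) j) \<partial>(S \<Otimes>\<^sub>M S))"
    by (subst integral_distr) (auto intro!: measurable_comb_seq simp: case_prod_beta)
  also have "\<dots> = (\<integral>p. F (fst p) * \<xi> (snd p 0) \<partial>(S \<Otimes>\<^sub>M S))"
  proof -
    have "F (comb_seq j w w') = F w" for w w' by (rule past) (simp add: comb_seq_def)
    then show ?thesis by (simp add: comb_seq_def)
  qed
  also have "\<dots> = (\<integral>w. (\<integral>w'. F w * \<xi> (w' 0) \<partial>S) \<partial>S)"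
    using SS.integral_fst'[OF int] by simp
  also have "\<dots> = 0" by (simp add: zero)
  finally show ?thesis .
qed

text \<open>The selection \<open>P k\<close> looks only at slots before \<open>k\<close>, so the
  summands are martingale differences and hence orthogonal. This covers selections that depend on
  the state, where the summands need not be independent.\<close>

lemma (in sequence_space) strong_law_predictable:
  fixes P :: "nat \<Rightarrow> (nat \<Rightarrow> 'a) \<Rightarrow> bool" and \<xi> :: "'a \<Rightarrow> real"
  assumes P [measurable]: "\<And>k. Measurable.pred S (P k)"
    and past: "\<And>k w w'. (\<And>i. i < k \<Longrightarrow> w i = w' i) \<Longrightarrow> P k w = P k w'"
    and \<xi> [measurable]: "\<xi> \<in> borel_measurable M" and \<xi>_bound: "\<And>x. x \<in> space M \<Longrightarrow> \<bar>\<xi> x\<bar> \<le> D"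
    and mean: "integral\<^sup>L M \<xi> = \<mu>"
  shows "AE w in S. (\<lambda>n. (\<Sum>k<n. of_bool (P k w) * (\<xi> (w k) - \<mu>)) / real n) \<longlonglongrightarrow> 0"
proof -
  have int: "integrable M \<xi>"
    by (rule M.integrable_const_bound[of _ D]) (auto simp: \<xi>_bound)
  have cen: "(\<integral>x. \<xi> x - \<mu> \<partial>M) = 0" using int mean by (simp add: M.prob_space)
  have cb: "\<bar>\<xi> x - \<mu>\<bar> \<le> D + \<bar>\<mu>\<bar>" if "x \<in> space M" for x using \<xi>_bound[OF that] by linarith
  define Y where "Y k w = of_bool (P k w) * (\<xi> (w k) - \<mu>)" for k w
  have comp [measurable]: "(\<lambda>w. \<xi> (w k)) \<in> borel_measurable S" for k by measurable
  have [measurable]: "Y k \<in> borel_measurable S" for k unfolding Y_def by measurable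
  have Yb: "\<bar>Y k w\<bar> \<le> D + \<bar>\<mu>\<bar>" if "w \<in> space S" for k w
  proof -
    have "w k \<in> space M" using that by (auto simp: space_PiM)
    from cb[OF this] show ?thesis by (auto simp: Y_def)
  qed
  have "AE w in S. (\<lambda>n. (\<Sum>k<n. Y k w) / real n) \<longlonglongrightarrow> 0"
  proof (rule strong_law_bounded_uncorrelated[where B = "D + \<bar>\<mu>\<bar>"])
    fix i j :: nat assume ij: "i < j"
    have "(\<integral>w. (Y i w * of_bool (P j w)) * (\<xi> (w j) - \<mu>) \<partial>S) = 0"
    proof (rule integral_predictable_mult_centered[where B = "D + \<bar>\<mu>\<bar>" and D = "D + \<bar>\<mu>\<bar>" and \<xi> = "\<lambda>x. \<xi> x - \<mu>"])
      fix w assume "w \<in> space S"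
      from Yb[OF this, of i] show "\<bar>Y i w * of_bool (P j w)\<bar> \<le> D + \<bar>\<mu>\<bar>" by (auto simp: abs_mult)
    next
      fix w w' :: "nat \<Rightarrow> 'a" assume eq: "\<And>i. i < j \<Longrightarrow> w i = w' i"
      have "P i w = P i w'" "P j w = P j w'" using ij eq by (auto intro!: past)
      then show "Y i w * of_bool (P j w) = Y i w' * of_bool (P j w')" using eq[OF ij] by (simp add: Y_def)
    qed (auto simp: cb cen)
    then show "(\<integral>w. Y i w * Y j w \<partial>S) = 0" by (simp add: Y_def mult.assoc)
  qed (auto simp: Yb)
  then show ?thesis by (simp add: Y_def)
qed

section \<open>Pathwise analysis of the threshold walk\<close>

text \<open>The count is constant between two times satisfying \<open>s\<close>, while the bound
  keeps growing. A bound at those times therefore extends to all times at the cost of one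
  unit.\<close>

lemma density_zero_if_small_at_hits:
  fixes s :: "nat \<Rightarrow> bool"
  assumes "\<And>\<epsilon>. 0 < \<epsilon> \<Longrightarrow> \<forall>\<^sub>F n in sequentially. s n \<longrightarrow> (\<Sum>k<n. of_bool (s k)) \<le> \<epsilon> * real n"
  shows "(\<lambda>n. (\<Sum>k<n. of_bool (s k)) / real n) \<longlonglongrightarrow> 0"
proof (rule LIMSEQ_I)
  fix e :: real assume e: "0 < e"
  obtain m where m: "\<And>n. m \<le> n \<Longrightarrow> s n \<Longrightarrow> (\<Sum>k<n. of_bool (s k)) \<le> e / 2 * real n"
    using assms[of "e / 2"] e by (auto simp: eventually_sequentially)
  \<comment> \<open>In the constant, \<open>m\<close> pays for the times before the assumed bound
    sets in and 1 for the slot being counted.\<close>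
  have bound: "(\<Sum>k<n. of_bool (s k)) \<le> e / 2 * real n + real (Suc m)" for n
  proof (induction n)
    case (Suc n)
    consider "\<not> s n" | "s n" "m \<le> n" | "n < m" by linarith
    then show ?case
    proof cases
      case 1
      then have "(\<Sum>k<Suc n. of_bool (s k)) = (\<Sum>k<n. of_bool (s k) :: real)" by (simp add: lessThan_Suc)
      moreover have "e / 2 * real n \<le> e / 2 * real (Suc n)" using e by (intro mult_left_mono) auto
      ultimately show ?thesis using Suc by linarith
    next
      case 2
      then have "(\<Sum>k<Suc n. of_bool (s k)) = (\<Sum>k<n. of_bool (s k) :: real) + 1" by (simp del: sum_of_bool_eq)
      moreover have "e / 2 * real n \<le> e / 2 * real (Suc n)" using e by (intro mult_left_mono) auto
      ultimately show ?thesis using m[of n] 2 by linarith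
    next
      case 3
      have "(\<Sum>k<Suc n. of_bool (s k)) \<le> (\<Sum>k<Suc n. 1 :: real)" by (intro sum_mono) auto
      moreover have "0 \<le> e / 2 * real (Suc n)" using e by simp
      ultimately show ?thesis using 3 by simp
    qed
  qed simp
  obtain l where l: "2 * real (Suc m) / e < real l" using reals_Archimedean2 by blast
  show "\<exists>no. \<forall>n\<ge>no. norm ((\<Sum>k<n. of_bool (s k)) / real n - 0) < e"
  proof (intro exI allI impI)
    fix n assume "Suc l \<le> n"
    then have n: "2 * real (Suc m) / e < real n" "0 < real n" using l by linarith+
    have "(\<Sum>k<n. of_bool (s k)) < e * real n"
      using bound[of n] n e by (simp add: field_simps)
    moreover have "0 \<le> (\<Sum>k<n. of_bool (s k) :: real)" by (intro sum_nonneg) auto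
    ultimately show "norm ((\<Sum>k<n. of_bool (s k)) / real n - 0) < e"
      using n by (simp add: divide_less_eq)
  qed
qed

text \<open>
  Here \<open>\<rho>\<close> stands for \<open>p\<^sub>c / N\<close>. The three kinds of atypical slots are bounded one after the other:
  a hit above the threshold is irreversible; the number of starved slots (below the threshold,
  no push) is controlled by energy at the starved slots themselves; and only starved slots can
  increase the deficit beyond one.
\<close>

lemma atypical_slots_density_zero:
  fixes C :: "nat \<Rightarrow> nat" and push hit :: "nat \<Rightarrow> bool" and \<rho> :: real
  assumes step: "\<And>k. C (Suc k) = (if push k then (if hit k then C k else C k + 1)
                                  else (if hit k then C k - 1 else C k))"
    and hit_pos: "\<And>k. hit k \<Longrightarrow> 0 < C k"
    and push_less: "\<And>k. push k \<Longrightarrow> C k < T"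
    and C_le: "\<And>k. C k \<le> N" and T_le: "T \<le> N"
    and \<rho>: "0 < \<rho>" "\<rho> * real N \<le> 1"
    and hits: "\<And>Q. (\<lambda>n. (\<Sum>k<n. of_bool (Q (C k) (push k)) * (of_bool (hit k) - \<rho> * real (C k))) / real n) \<longlonglongrightarrow> 0"
    and energy: "\<And>\<epsilon>. 0 < \<epsilon> \<Longrightarrow> \<forall>\<^sub>F n in sequentially. C n < T \<and> \<not> push n \<longrightarrow>
                   real n * (real T - \<epsilon>) \<le> (1 + 1 / \<rho>) * (\<Sum>k<n. of_bool (push k))"
  shows "(\<lambda>n. (\<Sum>k<n. of_bool (T < C k \<or> C k < T \<and> \<not> push k \<or> C k + 1 < T)) / real n) \<longlonglongrightarrow> 0"
proof -
  define over where "over n = (\<Sum>k<n. of_bool (T < C k) :: real)" for n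
  define starve where "starve n = (\<Sum>k<n. of_bool (C k < T \<and> \<not> push k) :: real)" for n
  define deep where "deep n = (\<Sum>k<n. of_bool (C k + 1 < T \<and> push k) :: real)" for n
  define pushes where "pushes n = (\<Sum>k<n. of_bool (push k) :: real)" for n
  define err where "err Q n = (\<Sum>k<n. of_bool (Q (C k) (push k)) * (of_bool (hit k) - \<rho> * real (C k)))" for Q n
  have err: "(\<lambda>n. err Q n / real n) \<longlonglongrightarrow> 0" for Q unfolding err_def by (rule hits)
  \<comment> \<open>Used for counts of slots in which some corrective event has conditional
    probability at least \<rho>; \<open>g\<close> is then the number of such events plus an
    error.\<close>
  have sandwich: "(\<lambda>n. f n / real n) \<longlonglongrightarrow> 0"
    if nonneg: "\<And>n. 0 \<le> f n" and le: "\<And>n. \<rho> * f n \<le> g n" and g: "(\<lambda>n. g n / real n) \<longlonglongrightarrow> 0" for f g :: "nat \<Rightarrow> real"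
  proof (rule tendsto_sandwich[OF _ _ tendsto_const])
    show "(\<lambda>n. g n / real n / \<rho>) \<longlonglongrightarrow> 0" using tendsto_divide[OF g tendsto_const[of \<rho>]] \<rho> by simp
    show "\<forall>\<^sub>F n in sequentially. f n / real n \<le> g n / real n / \<rho>"
    proof (intro always_eventually allI)
      fix n
      have "f n \<le> g n / \<rho>" using le[of n] \<rho> by (simp add: field_simps)
      then show "f n / real n \<le> g n / real n / \<rho>"
        using divide_right_mono[of "f n" "g n / \<rho>" "real n"] by (simp add: mult.commute)
    qed
  qed (use nonneg in auto)

  have over: "(\<lambda>n. over n / real n) \<longlonglongrightarrow> 0"
  proof (rule sandwich)
    fix n
    \<comment> \<open>The truncated excess over \<open>T\<close> drops by one at each hit above
      \<open>T\<close> and never grows, as pushes happen only below \<open>T\<close>.\<close>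
    have tele: "(\<Sum>k<n. of_bool (T < C k \<and> hit k) :: real) + real (C n - T) = real (C 0 - T)"
    proof (induction n)
      case (Suc n)
      have "of_bool (T < C n \<and> hit n) + real (C (Suc n) - T) = real (C n - T)"
        using step[of n] push_less[of n] by auto
      then show ?case using Suc by simp
    qed simp
    \<comment> \<open>Above the threshold \<open>C k\<close> is at least 1, so a hit has probability
      at least \<rho>.\<close>
    have "\<rho> * over n \<le> (\<Sum>k<n. of_bool (T < C k) * (\<rho> * real (C k)))"
      unfolding over_def sum_distrib_left using \<rho> by (intro sum_mono) auto
    also have "\<dots> = (\<Sum>k<n. of_bool (T < C k \<and> hit k)) - err (\<lambda>c b. T < c) n"
      unfolding err_def sum_subtractf[symmetric] by (intro sum.cong) auto
    also have "\<dots> \<le> real N - err (\<lambda>c b. T < c) n"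
      using tele C_le[of 0] by linarith
    finally show "\<rho> * over n \<le> real N - err (\<lambda>c b. T < c) n" .
  next
    show "(\<lambda>n. (real N - err (\<lambda>c b. T < c) n) / real n) \<longlonglongrightarrow> 0"
      using tendsto_diff[OF lim_const_over_n[of "real N"] err[of "\<lambda>c b. T < c"]]
      by (simp add: diff_divide_distrib)
  qed (auto simp: over_def intro!: sum_nonneg)

  \<comment> \<open>All negligible terms of the balance: the bounded change of \<open>C\<close>, the
    fluctuation of the hits, and the slots above the threshold.\<close>
  define r where "r n = (real N + err (\<lambda>c b. True) n) / \<rho> + real N * over n" for n
  have r: "(\<lambda>n. r n / real n) \<longlonglongrightarrow> 0"
  proof -
    have "(\<lambda>n. (real N / real n + err (\<lambda>c b. True) n / real n) / \<rho> + real N * (over n / real n)) \<longlonglongrightarrow> (0 + 0) / \<rho> + real N * 0"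
      using \<rho> by (intro tendsto_intros lim_const_over_n err over) auto
    then show ?thesis by (simp add: r_def add_divide_distrib mult.commute)
  qed
  have starve_le: "starve n \<le> real n * real T - (1 + 1 / \<rho>) * pushes n + r n" for n
  proof -
    \<comment> \<open>By \<open>hit_pos\<close> the natural subtraction in \<open>step\<close> never
      truncates.\<close>
    have bal: "real (C n) = real (C 0) + pushes n - (\<Sum>k<n. of_bool (hit k))"
    proof (induction n)
      case (Suc n)
      have "real (C (Suc n)) = real (C n) + of_bool (push n) - of_bool (hit n)"
        using step[of n] hit_pos[of n] by (auto simp: of_nat_diff)
      then show ?case using Suc by (simp add: pushes_def)
    qed (simp add: pushes_def)
    have "(\<Sum>k<n. real (C k)) \<le> (\<Sum>k<n. real T - of_bool (push k) - of_bool (C k < T \<and> \<not> push k) + real N * of_bool (T < C k))"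
    proof (rule sum_mono)
      fix k
      show "real (C k) \<le> real T - of_bool (push k) - of_bool (C k < T \<and> \<not> push k) + real N * of_bool (T < C k)"
        using push_less[of k] C_le[of k] by (cases "C k < T"; cases "push k") auto
    qed
    also have "\<dots> = real n * real T - pushes n - starve n + real N * over n"
      by (simp add: pushes_def starve_def over_def sum.distrib sum_subtractf sum_distrib_left)
    finally have avg: "\<rho> * (\<Sum>k<n. real (C k)) \<le> \<rho> * (real n * real T - pushes n - starve n + real N * over n)"
      using \<rho> by (intro mult_left_mono) auto
    have "(\<Sum>k<n. of_bool (hit k)) = \<rho> * (\<Sum>k<n. real (C k)) + err (\<lambda>c b. True) n"
      by (simp add: err_def sum_subtractf sum_distrib_left)
    then have "pushes n - real N \<le> \<rho> * (real n * real T - pushes n - starve n + real N * over n) + err (\<lambda>c b. True) n"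
      using avg bal C_le[of n] by linarith
    also have "\<rho> * (real n * real T - pushes n - starve n + real N * over n) + err (\<lambda>c b. True) n
        = \<rho> * (real n * real T - (1 + 1 / \<rho>) * pushes n + r n - starve n) + (pushes n - real N)"
      using \<rho> by (simp add: r_def add_divide_distrib distrib_left right_diff_distrib left_diff_distrib distrib_right)
    finally have "0 \<le> \<rho> * (real n * real T - (1 + 1 / \<rho>) * pushes n + r n - starve n)" by simp
    then show ?thesis using \<rho> by (simp add: zero_le_mult_iff)
  qed

  have starve: "(\<lambda>n. starve n / real n) \<longlonglongrightarrow> 0"
    unfolding starve_def
  proof (rule density_zero_if_small_at_hits)
    fix \<epsilon> :: real assume \<epsilon>: "0 < \<epsilon>"
    \<comment> \<open>One half of \<epsilon> pays for \<open>r\<close>, the other for the slack in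
      \<open>energy\<close>; inserted in \<open>starve_le\<close>, they leave at most
      \<open>\<epsilon> * n\<close>.\<close>
    have "\<forall>\<^sub>F n in sequentially. r n / real n < \<epsilon> / 2"
      using r \<epsilon> by (intro order_tendstoD(2)[OF r]) auto
    moreover have "\<forall>\<^sub>F n in sequentially. C n < T \<and> \<not> push n \<longrightarrow>
                   real n * (real T - \<epsilon> / 2) \<le> (1 + 1 / \<rho>) * pushes n"
      unfolding pushes_def using \<epsilon> by (intro energy) auto
    ultimately show "\<forall>\<^sub>F n in sequentially. C n < T \<and> \<not> push n \<longrightarrow>
        (\<Sum>k<n. of_bool (C k < T \<and> \<not> push k)) \<le> \<epsilon> * real n"
      using eventually_gt_at_top[of 0]
    proof eventually_elim
      case (elim n)
      have "r n \<le> \<epsilon> / 2 * real n" using elim by (simp add: field_simps)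
      then show ?case
        using elim starve_le[of n] unfolding starve_def by (auto simp: algebra_simps simp del: sum_of_bool_eq)
    qed
  qed

  have deep: "(\<lambda>n. deep n / real n) \<longlonglongrightarrow> 0"
  proof (rule sandwich)
    fix n
    \<comment> \<open>The potential \<open>T - 1 - C\<close> is truncated at 0, so a hit that moves
      \<open>C\<close> from \<open>T\<close> to \<open>T - 1\<close> costs nothing. Only a hit in a
      starved slot raises it, and each push without a hit from below \<open>T - 1\<close> lowers it
      by one.\<close>
    have tele: "(\<Sum>k<n. of_bool (C k + 1 < T \<and> push k \<and> \<not> hit k)) + real (T - 1 - C n)
        \<le> real (T - 1 - C 0) + starve n"
    proof (induction n)
      case (Suc n)
      have "of_bool (C n + 1 < T \<and> push n \<and> \<not> hit n) + real (T - 1 - C (Suc n))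
          \<le> real (T - 1 - C n) + of_bool (C n < T \<and> \<not> push n)"
        using step[of n] by (cases "push n"; cases "hit n") auto
      then show ?case using Suc by (simp add: starve_def)
    qed (simp add: starve_def)
    have "\<rho> * deep n \<le> (\<Sum>k<n. of_bool (C k + 1 < T \<and> push k) * (1 - \<rho> * real (C k)))"
      unfolding deep_def sum_distrib_left
    proof (rule sum_mono)
      fix k
      \<comment> \<open>The chance that a push gains a content is at least \<rho>, since
        \<open>C k + 1\<close> is at most \<open>N\<close> here.\<close>
      have "\<rho> \<le> 1 - \<rho> * real (C k)" if "C k + 1 < T"
      proof -
        have "\<rho> * real (C k + 1) \<le> \<rho> * real N" using that T_le \<rho> by (intro mult_left_mono) auto
        then show ?thesis using \<rho> by (simp add: algebra_simps)
      qed
      then show "\<rho> * of_bool (C k + 1 < T \<and> push k) \<le> of_bool (C k + 1 < T \<and> push k) * (1 - \<rho> * real (C k))"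
        by auto
    qed
    also have "\<dots> = (\<Sum>k<n. of_bool (C k + 1 < T \<and> push k \<and> \<not> hit k)) + err (\<lambda>c b. c + 1 < T \<and> b) n"
      unfolding err_def sum.distrib[symmetric] by (intro sum.cong) auto
    also have "\<dots> \<le> real N + starve n + err (\<lambda>c b. c + 1 < T \<and> b) n"
      using tele T_le by linarith
    finally show "\<rho> * deep n \<le> real N + starve n + err (\<lambda>c b. c + 1 < T \<and> b) n" .
  next
    show "(\<lambda>n. (real N + starve n + err (\<lambda>c b. c + 1 < T \<and> b) n) / real n) \<longlonglongrightarrow> 0"
      using tendsto_add[OF tendsto_add[OF lim_const_over_n[of "real N"] starve] err[of "\<lambda>c b. c + 1 < T \<and> b"]]
      by (simp add: add_divide_distrib)
  qed (auto simp: deep_def intro!: sum_nonneg)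

  show ?thesis
  proof (rule tendsto_sandwich[OF _ _ tendsto_const])
    show "(\<lambda>n. over n / real n + starve n / real n + deep n / real n) \<longlonglongrightarrow> 0"
      using tendsto_add[OF tendsto_add[OF over starve] deep] by simp
    show "\<forall>\<^sub>F n in sequentially. (\<Sum>k<n. of_bool (T < C k \<or> C k < T \<and> \<not> push k \<or> C k + 1 < T)) / real n
        \<le> over n / real n + starve n / real n + deep n / real n"
    proof (intro always_eventually allI)
      fix n
      have "(\<Sum>k<n. of_bool (T < C k \<or> C k < T \<and> \<not> push k \<or> C k + 1 < T)) \<le> over n + starve n + deep n"
        unfolding over_def starve_def deep_def sum.distrib[symmetric] by (intro sum_mono) auto
      then show "(\<Sum>k<n. of_bool (T < C k \<or> C k < T \<and> \<not> push k \<or> C k + 1 < T)) / real n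
          \<le> over n / real n + starve n / real n + deep n / real n"
        unfolding add_divide_distrib[symmetric] by (intro divide_right_mono) auto
    qed
  qed (intro always_eventually allI divide_nonneg_nonneg sum_nonneg; simp)
qed

section \<open>The law of the slots\<close>

locale slot_process =
  fixes N :: nat and v pc pu Abar :: real and H :: "real measure"
  assumes N: "1 \<le> N" and pc: "0 < pc" "pc \<le> 1" and pu: "0 \<le> pu" "pu \<le> 1"
    and H: "prob_space H" and sets_H: "sets H = sets borel"
    and H_nonneg: "AE a in H. 0 \<le> a" and H_int: "integrable H (\<lambda>a. a)" and H_mean: "(\<integral>a. a \<partial>H) = Abar"
begin

sublocale H: prob_space H by (rule H)

abbreviation "slot \<equiv> slot_measure pc pu N v H"

sublocale disc_H: pair_prob_space "measure_pmf (disc_pmf pc pu N v)" H ..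

sublocale slots: sequence_space slot
proof -
  interpret slot: prob_space slot
    unfolding slot_measure_def by (rule prob_space_pair) unfold_locales
  show "sequence_space slot" ..
qed

lemma slots_measure_eq: "slots_measure pc pu N v H = slots.S"
  by (simp add: slots_measure_def)

lemma sets_slot [measurable_cong]: "sets slot = sets (count_space UNIV \<Otimes>\<^sub>M borel)"
  unfolding slot_measure_def by (intro sets_pair_measure_cong) (auto simp: sets_H)

lemma distr_slot_fst: "distr slot (count_space UNIV) fst = measure_pmf (disc_pmf pc pu N v)"
proof -
  have "distr slot (measure_pmf (disc_pmf pc pu N v)) fst = measure_pmf (disc_pmf pc pu N v)"
    unfolding slot_measure_def by (rule H.distr_pair_fst)
  moreover have "distr slot (count_space UNIV) fst = distr slot (measure_pmf (disc_pmf pc pu N v)) fst"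
    by (intro distr_cong) auto
  ultimately show ?thesis by simp
qed

lemma distr_slot_snd: "distr slot H snd = H"
proof -
  have "distr slot H snd = distr (H \<Otimes>\<^sub>M measure_pmf (disc_pmf pc pu N v)) H (snd \<circ> (\<lambda>(x, y). (y, x)))"
    unfolding slot_measure_def
    by (subst disc_H.distr_pair_swap, subst distr_distr) auto
  also have "\<dots> = distr (H \<Otimes>\<^sub>M measure_pmf (disc_pmf pc pu N v)) H fst"
    by (intro distr_cong) auto
  also have "\<dots> = H" by (rule measure_pmf.distr_pair_fst)
  finally show ?thesis .
qed

lemma integral_slot_disc: "(\<integral>x. (of_bool (Q (fst x)) :: real) \<partial>slot) = measure_pmf.prob (disc_pmf pc pu N v) {d. Q d}"
proof -
  have "(\<integral>x. (of_bool (Q (fst x)) :: real) \<partial>slot) = (\<integral>d. (of_bool (Q d) :: real) \<partial>distr slot (count_space UNIV) fst)"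
    by (subst integral_distr) auto
  also have "\<dots> = (\<integral>d. indicator {d. Q d} d \<partial>measure_pmf (disc_pmf pc pu N v))"
    unfolding distr_slot_fst by (intro Bochner_Integration.integral_cong) (auto simp: indicator_def)
  finally show ?thesis by simp
qed

text \<open>The removal flag and the removed rank are independent, and \<open>c\<close> of the
  \<open>N\<close> ranks count as hits. Beyond \<open>N\<close> this share would saturate at 1,
  hence the bound on \<open>c\<close>.\<close>

lemma hit_probability:
  assumes "c \<le> N"
  shows "(\<integral>x. (of_bool (fst (fst x) \<and> fst (snd (fst x)) \<le> c) :: real) \<partial>slot) = pc / real N * real c"
proof -
  have "measure_pmf.prob (disc_pmf pc pu N v) {d. fst d \<and> fst (snd d) \<le> c}
      = measure_pmf.prob (disc_pmf pc pu N v) ({True} \<times> ({..c} \<times> UNIV))"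
    by (intro arg_cong2[where f = measure]) auto
  also have "\<dots> = pc * measure_pmf.prob (pmf_of_set {1..N}) {..c}"
    using pc by (simp add: disc_pmf_def measure_pmf_prob_product measure_pmf_single)
  also have "measure_pmf.prob (pmf_of_set {1..N}) {..c} = real (card ({1..N} \<inter> {..c})) / real N"
    using N by (subst measure_pmf_of_set) auto
  also have "{1..N} \<inter> {..c} = {1..c}" using assms by auto
  finally show ?thesis by (subst integral_slot_disc) simp
qed

text \<open>With \<open>T\<close> the threshold, this is the blocking probability to be
  reached.\<close>

lemma request_probability:
  "(\<integral>x. (of_bool (\<exists>i>T. snd (snd (fst x)) = Some i) :: real) \<partial>slot) = pu * (1 - (\<Sum>i=1..T. zipf N v i))"
proof -
  have "measure_pmf.prob (disc_pmf pc pu N v) {d. \<exists>i>T. snd (snd d) = Some i}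
      = measure_pmf.prob (disc_pmf pc pu N v) (UNIV \<times> (UNIV \<times> (Some ` {T<..})))"
    by (intro arg_cong2[where f = measure]) auto
  also have "\<dots> = measure_pmf.prob (request_pmf pu N v) (Some ` {T<..})"
    by (simp add: disc_pmf_def measure_pmf_prob_product)
  also have "\<dots> = pu * measure_pmf.prob (zipf_pmf N v) {T<..}"
  proof -
    have "Some -` Some ` {T<..} = {T<..}" by auto
    then have "emeasure (request_pmf pu N v) (Some ` {T<..}) = ennreal pu * emeasure (zipf_pmf N v) {T<..}"
      using pu by (simp add: request_pmf_def emeasure_bind_pmf mult.commute)
    then show ?thesis
      using pu by (simp add: measure_pmf.emeasure_eq_measure ennreal_mult''[symmetric])
  qed
  also have "measure_pmf.prob (zipf_pmf N v) {T<..} = 1 - measure_pmf.prob (zipf_pmf N v) {..T}"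
  proof -
    have "{T<..} = UNIV - {..T}" by auto
    then show ?thesis using measure_pmf.prob_compl[of "{..T}" "zipf_pmf N v"] by simp
  qed
  \<comment> \<open>The extra rank 0 in \<open>{..T}\<close> has mass 0.\<close>
  also have "measure_pmf.prob (zipf_pmf N v) {..T} = (\<Sum>i=1..T. zipf N v i)"
    using N by (subst measure_measure_pmf_finite)
      (auto simp: pmf_zipf_pmf zipf_def intro!: sum.mono_neutral_cong_right)
  finally show ?thesis by (subst integral_slot_disc) simp
qed

text \<open>Rank 0 would hit even an empty cache; excluding it yields \<open>hit_pos\<close> in the
  pathwise analysis. Nonnegative harvests justify truncation from above.\<close>

lemma AE_slots_proper: "AE w in slots.S. \<forall>k. 1 \<le> fst (snd (fst (w k))) \<and> 0 \<le> snd (w k)"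
proof -
  have "AE d in measure_pmf (disc_pmf pc pu N v). 1 \<le> fst (snd d)"
    using N by (auto simp: AE_measure_pmf_iff disc_pmf_def)
  then have "AE d in distr slot (count_space UNIV) fst. 1 \<le> fst (snd d)" by (simp only: distr_slot_fst)
  then have 1: "AE x in slot. 1 \<le> fst (snd (fst x))" by (intro AE_distrD[of fst slot "count_space UNIV" "\<lambda>d. 1 \<le> fst (snd d)"]) auto
  have 2: "AE x in slot. 0 \<le> snd x"
  proof (rule AE_distrD[of snd slot H "\<lambda>a. 0 \<le> a"])
    show "snd \<in> slot \<rightarrow>\<^sub>M H" unfolding slot_measure_def by measurable
    show "AE x in distr slot H snd. 0 \<le> x" unfolding distr_slot_snd by (rule H_nonneg)
  qed
  show ?thesis
    unfolding AE_all_countable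
  proof
    fix k
    show "AE w in slots.S. 1 \<le> fst (snd (fst (w k))) \<and> 0 \<le> snd (w k)"
      by (rule slots.AE_component[OF UNIV_I AE_conjI[OF 1 2]])
  qed
qed

text \<open>
  Since harvested energy is nonnegative, truncating it costs nothing for a lower bound, so the
  strong law for bounded variables suffices although only the first moment is assumed finite.
\<close>

lemma harvest_lower_bound:
  "AE w in slots.S. \<forall>\<delta>>0. \<forall>\<^sub>F n in sequentially. real n * (Abar - \<delta>) \<le> (\<Sum>k<n. snd (w k))"
proof -
  \<comment> \<open>The outer \<open>max 0\<close> makes the truncation bounded everywhere, as the
    strong law demands, although harvests are nonnegative only almost everywhere.\<close>
  define trunc where "trunc m a = max 0 (min a (real m))" for m :: nat and a
  define \<mu> where "\<mu> m = (\<integral>a. trunc m a \<partial>H)" for m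
  have [measurable]: "trunc m \<in> borel_measurable borel" for m unfolding trunc_def by measurable
  have [measurable]: "trunc m \<in> borel_measurable H" for m
    unfolding measurable_cong_sets[OF sets_H refl] by measurable
  have lim: "\<mu> \<longlonglongrightarrow> Abar"
    unfolding \<mu>_def H_mean[symmetric]
  proof (rule integral_dominated_convergence[where w = "\<lambda>a. \<bar>a\<bar>"])
    show "AE a in H. (\<lambda>m. trunc m a) \<longlonglongrightarrow> a"
      using H_nonneg
    proof eventually_elim
      fix a :: real assume a: "0 \<le> a"
      have "\<forall>\<^sub>F m in sequentially. trunc m a = a"
        using eventually_ge_at_top[of "nat \<lceil>a\<rceil>"]
        by eventually_elim (use a in \<open>auto simp: trunc_def min_def nat_le_iff ceiling_le_iff\<close>)
      then show "(\<lambda>m. trunc m a) \<longlonglongrightarrow> a" by (rule tendsto_eventually)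
    qed
    show "integrable H (\<lambda>a. \<bar>a\<bar>)" by (rule integrable_abs[OF H_int])
    show "(\<lambda>a. a) \<in> borel_measurable H" by (rule borel_measurable_integrable[OF H_int])
    show "trunc m \<in> borel_measurable H" for m by fact
    show "AE a in H. norm (trunc m a) \<le> \<bar>a\<bar>" for m by (rule AE_I2) (auto simp: trunc_def)
  qed
  \<comment> \<open>The level \<open>m\<close> is chosen only after \<delta>, so one null set must
    serve all levels.\<close>
  have "AE w in slots.S. \<forall>m. (\<lambda>n. (\<Sum>k<n. of_bool True * (trunc m (snd (w k)) - \<mu> m)) / real n) \<longlonglongrightarrow> 0"
    unfolding AE_all_countable
  proof
    fix m
    show "AE w in slots.S. (\<lambda>n. (\<Sum>k<n. of_bool True * (trunc m (snd (w k)) - \<mu> m)) / real n) \<longlonglongrightarrow> 0"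
    proof (rule slots.strong_law_predictable[where \<xi> = "\<lambda>x. trunc m (snd x)" and D = "real m"])
      have "(\<integral>x. trunc m (snd x) \<partial>slot) = (\<integral>a. trunc m a \<partial>distr slot H snd)"
        by (subst integral_distr) (auto simp: slot_measure_def)
      then show "(\<integral>x. trunc m (snd x) \<partial>slot) = \<mu> m" by (simp add: distr_slot_snd \<mu>_def)
    qed (auto simp: trunc_def)
  qed
  then show ?thesis
    using AE_slots_proper
  proof eventually_elim
    case (elim w)
    show ?case
    proof (intro allI impI)
      fix \<delta> :: real assume \<delta>: "0 < \<delta>"
      have "\<forall>\<^sub>F m in sequentially. Abar - \<delta> / 2 < \<mu> m" using \<delta> by (intro order_tendstoD(1)[OF lim]) auto
      then obtain m where m: "Abar - \<delta> / 2 < \<mu> m" by (auto simp: eventually_sequentially)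
      have "\<forall>\<^sub>F n in sequentially. - (\<delta> / 2) < (\<Sum>k<n. of_bool True * (trunc m (snd (w k)) - \<mu> m)) / real n"
        using elim(1) \<delta> by (intro order_tendstoD(1)[of _ 0]) auto
      then show "\<forall>\<^sub>F n in sequentially. real n * (Abar - \<delta>) \<le> (\<Sum>k<n. snd (w k))"
        using eventually_gt_at_top[of 0]
      proof eventually_elim
        case (elim n)
        then have "- (\<delta> / 2) * real n < (\<Sum>k<n. trunc m (snd (w k))) - real n * \<mu> m"
          by (simp add: less_divide_eq sum_subtractf)
        moreover have "real n * (Abar - \<delta> / 2) \<le> real n * \<mu> m" using m by (intro mult_left_mono) auto
        moreover have "(\<Sum>k<n. trunc m (snd (w k))) \<le> (\<Sum>k<n. snd (w k))"
          using \<open>\<forall>k. 1 \<le> fst (snd (fst (w k))) \<and> 0 \<le> snd (w k)\<close>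
          by (intro sum_mono) (auto simp: trunc_def)
        ultimately show ?case by (simp add: algebra_simps)
      qed
    qed
  qed
qed

end

section \<open>The state as a measurable function of the earlier slots\<close>

lemma potb_state_past:
  "(\<And>i. i < k \<Longrightarrow> w i = w' i) \<Longrightarrow> potb_state T Ep C0 E0 w k = potb_state T Ep C0 E0 w' k"
  by (induction k) auto

lemma measurable_potb_state:
  assumes [measurable_cong]: "sets M = sets (count_space UNIV \<Otimes>\<^sub>M borel)"
  shows "(\<lambda>w. potb_state T Ep C0 E0 w k) \<in> (\<Pi>\<^sub>M i\<in>UNIV. M) \<rightarrow>\<^sub>M count_space UNIV \<Otimes>\<^sub>M borel"
proof (induction k)
  case (Suc k)
  note Suc.IH [measurable]
  let ?st = "\<lambda>w. potb_state T Ep C0 E0 w k"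
  have [measurable]: "(\<lambda>w. fst (?st w)) \<in> (\<Pi>\<^sub>M i\<in>UNIV. M) \<rightarrow>\<^sub>M count_space UNIV"
    "(\<lambda>w. snd (?st w)) \<in> (\<Pi>\<^sub>M i\<in>UNIV. M) \<rightarrow>\<^sub>M borel" by measurable
  have [measurable]: "(\<lambda>w. fst (w k)) \<in> (\<Pi>\<^sub>M i\<in>UNIV. M) \<rightarrow>\<^sub>M count_space UNIV"
    "(\<lambda>w. snd (w k)) \<in> (\<Pi>\<^sub>M i\<in>UNIV. M) \<rightarrow>\<^sub>M borel" by measurable
  have [measurable]: "Measurable.pred (\<Pi>\<^sub>M i\<in>UNIV. M) (\<lambda>w. potb_push T Ep (fst (?st w)) (snd (?st w)))"
    unfolding potb_push_def by measurable
  have [measurable]: "(\<lambda>w. fst (fst (w k))) \<in> (\<Pi>\<^sub>M i\<in>UNIV. M) \<rightarrow>\<^sub>M count_space UNIV"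
    "(\<lambda>w. fst (snd (fst (w k)))) \<in> (\<Pi>\<^sub>M i\<in>UNIV. M) \<rightarrow>\<^sub>M count_space UNIV"
    by (rule measurable_compose[of "\<lambda>w. fst (w k)" _ "count_space UNIV"]; simp)+
  have eq: "potb_state T Ep C0 E0 w (Suc k) =
     (if potb_push T Ep (fst (?st w)) (snd (?st w))
      then (if fst (fst (w k)) \<and> fst (snd (fst (w k))) \<le> fst (?st w) then fst (?st w) else fst (?st w) + 1)
      else (if fst (fst (w k)) \<and> fst (snd (fst (w k))) \<le> fst (?st w) then fst (?st w) - 1 else fst (?st w)),
      snd (?st w) - (if potb_push T Ep (fst (?st w)) (snd (?st w)) then Ep else 0) + snd (w k))" for w
    by (simp add: Let_def case_prod_beta)
  show ?case unfolding eq by measurable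
qed simp

section \<open>The push-only threshold policy\<close>

text \<open>The second bound on \<open>T\<close> is sustainability: balancing pushes against hits at
  the threshold gives the push rate \<open>T * pc / (N + pc)\<close>, and the bound says that
  \<open>Ep\<close> times this rate is at most the mean harvest.\<close>

locale potb_process = slot_process +
  fixes Ep E0 :: real and T C0 :: nat
  assumes Ep: "0 < Ep" and C0: "C0 \<le> N" and E0: "0 \<le> E0"
    and T: "T \<le> N" "real T \<le> (real N + pc) * Abar / (pc * Ep)"
begin

definition cached :: "(nat \<Rightarrow> slot) \<Rightarrow> nat \<Rightarrow> nat" where
  "cached w k = fst (potb_state T Ep C0 E0 w k)"

definition battery :: "(nat \<Rightarrow> slot) \<Rightarrow> nat \<Rightarrow> real" where
  "battery w k = snd (potb_state T Ep C0 E0 w k)"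

definition push :: "(nat \<Rightarrow> slot) \<Rightarrow> nat \<Rightarrow> bool" where
  "push w k = potb_push T Ep (cached w k) (battery w k)"

definition hit :: "(nat \<Rightarrow> slot) \<Rightarrow> nat \<Rightarrow> bool" where
  "hit w k = (fst (fst (w k)) \<and> fst (snd (fst (w k))) \<le> cached w k)"

lemma cached_Suc: "cached w (Suc k) =
    (if push w k then (if hit w k then cached w k else cached w k + 1)
     else (if hit w k then cached w k - 1 else cached w k))"
  by (simp add: cached_def battery_def push_def hit_def Let_def case_prod_beta)

lemma battery_Suc: "battery w (Suc k) = battery w k - (if push w k then Ep else 0) + snd (w k)"
  by (simp add: cached_def battery_def push_def Let_def case_prod_beta)

lemma push_cached_less: "push w k \<Longrightarrow> cached w k < T"
  by (simp add: push_def potb_push_def)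

lemma cached_le: "cached w k \<le> N"
proof (induction k)
  case 0
  then show ?case using C0 by (simp add: cached_def)
next
  case (Suc k)
  then show ?case using push_cached_less[of w k] T by (auto simp: cached_Suc)
qed

lemma battery_eq: "battery w n = E0 + (\<Sum>k<n. snd (w k)) - Ep * (\<Sum>k<n. of_bool (push w k))"
proof (induction n)
  case (Suc n)
  then show ?case by (simp add: battery_Suc distrib_left del: sum_of_bool_eq)
qed (simp add: battery_def)

lemma potb_blocked_eq: "potb_blocked T Ep C0 E0 w k \<longleftrightarrow>
    (\<exists>i>cached w k. snd (snd (fst (w k))) = Some i \<and> \<not> (push w k \<and> i = cached w k + 1))"
  by (auto simp: potb_blocked_def cached_def battery_def push_def Let_def case_prod_beta split: option.split)

text \<open>The hit probability varies with the state, so the strong law is applied for each cache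
  size and push decision separately. These pairs are countably many and fix the null set before
  \<open>Q\<close> is chosen; each \<open>Q\<close> is then a finite sum over them.\<close>

lemma AE_hits:
  "AE w in slots.S. \<forall>Q. (\<lambda>n. (\<Sum>k<n. of_bool (Q (cached w k) (push w k)) *
      (of_bool (hit w k) - pc / real N * real (cached w k))) / real n) \<longlonglongrightarrow> 0"
proof -
  define hit_at :: "nat \<Rightarrow> slot \<Rightarrow> bool"
    where "hit_at c x = (fst (fst x) \<and> fst (snd (fst x)) \<le> c)" for c x
  have "AE w in slots.S. c \<le> N \<longrightarrow> (\<lambda>n. (\<Sum>k<n. of_bool (cached w k = c \<and> push w k = b) *
      (of_bool (hit_at c (w k)) - pc / real N * real c)) / real n) \<longlonglongrightarrow> 0" for c b
  proof (cases "c \<le> N")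
    case True
    have "AE w in slots.S. (\<lambda>n. (\<Sum>k<n. of_bool (cached w k = c \<and> push w k = b) *
        (of_bool (hit_at c (w k)) - pc / real N * real c)) / real n) \<longlonglongrightarrow> 0"
    proof (rule slots.strong_law_predictable[where P = "\<lambda>k w. cached w k = c \<and> push w k = b" and D = 1])
      fix k
      note measurable_potb_state[OF sets_slot, measurable]
      have [measurable]: "(\<lambda>w. cached w k) \<in> slots.S \<rightarrow>\<^sub>M count_space UNIV"
        "(\<lambda>w. battery w k) \<in> slots.S \<rightarrow>\<^sub>M borel"
        unfolding cached_def battery_def by measurable
      show "Measurable.pred slots.S (\<lambda>w. cached w k = c \<and> push w k = b)"
        unfolding push_def potb_push_def by measurable
    next
      fix k and w w' :: "nat \<Rightarrow> slot"
      assume "\<And>i. i < k \<Longrightarrow> w i = w' i"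
      then have "potb_state T Ep C0 E0 w k = potb_state T Ep C0 E0 w' k" by (rule potb_state_past)
      then show "(cached w k = c \<and> push w k = b) = (cached w' k = c \<and> push w' k = b)"
        by (simp add: cached_def battery_def push_def)
    next
      have "(\<lambda>x. of_bool (hit_at c x) :: real) = (\<lambda>d. of_bool (fst d \<and> fst (snd d) \<le> c)) \<circ> fst"
        by (auto simp: hit_at_def)
      also have "\<dots> \<in> borel_measurable slot"
        by (rule measurable_comp[of _ _ "count_space UNIV"]) auto
      finally show "(\<lambda>x. of_bool (hit_at c x) :: real) \<in> borel_measurable slot" .
      show "(\<integral>x. (of_bool (hit_at c x) :: real) \<partial>slot) = pc / real N * real c"
        unfolding hit_at_def by (rule hit_probability[OF True])
    qed auto
    then show ?thesis by eventually_elim simp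
  qed simp
  then have "AE w in slots.S. \<forall>c b. c \<le> N \<longrightarrow> (\<lambda>n. (\<Sum>k<n. of_bool (cached w k = c \<and> push w k = b) *
      (of_bool (hit_at c (w k)) - pc / real N * real c)) / real n) \<longlonglongrightarrow> 0"
    by (simp add: AE_all_countable)
  then show ?thesis
  proof (eventually_elim, intro allI)
    fix w and Q :: "nat \<Rightarrow> bool \<Rightarrow> bool"
    let ?I = "{..N} \<times> (UNIV :: bool set)"
    define X where "X cb k = of_bool (cached w k = fst cb \<and> push w k = snd cb) *
        (of_bool (hit_at (fst cb) (w k)) - pc / real N * real (fst cb))" for cb k
    assume lim: "\<forall>c b. c \<le> N \<longrightarrow> (\<lambda>n. (\<Sum>k<n. of_bool (cached w k = c \<and> push w k = b) *
      (of_bool (hit_at c (w k)) - pc / real N * real c)) / real n) \<longlonglongrightarrow> 0"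
    have "(\<lambda>n. \<Sum>cb\<in>?I. of_bool (Q (fst cb) (snd cb)) * ((\<Sum>k<n. X cb k) / real n)) \<longlonglongrightarrow> 0"
      using lim by (intro tendsto_null_sum tendsto_mult_right_zero) (auto simp: X_def)
    moreover have "(\<Sum>cb\<in>?I. of_bool (Q (fst cb) (snd cb)) * ((\<Sum>k<n. X cb k) / real n))
        = (\<Sum>k<n. of_bool (Q (cached w k) (push w k)) *
            (of_bool (hit w k) - pc / real N * real (cached w k))) / real n" for n
    proof -
      have "(\<Sum>cb\<in>?I. of_bool (Q (fst cb) (snd cb)) * X cb k) = of_bool (Q (cached w k) (push w k)) *
            (of_bool (hit w k) - pc / real N * real (cached w k))" for k
      proof -
        have "(\<Sum>cb\<in>?I. of_bool (Q (fst cb) (snd cb)) * X cb k) = (\<Sum>cb\<in>?I. if cb = (cached w k, push w k)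
            then of_bool (Q (cached w k) (push w k)) * (of_bool (hit w k) - pc / real N * real (cached w k)) else 0)"
          by (intro sum.cong) (auto simp: X_def hit_def hit_at_def)
        then show ?thesis by (simp add: cached_le)
      qed
      moreover have "(\<Sum>cb\<in>?I. of_bool (Q (fst cb) (snd cb)) * (\<Sum>k<n. X cb k))
          = (\<Sum>k<n. \<Sum>cb\<in>?I. of_bool (Q (fst cb) (snd cb)) * X cb k)"
        unfolding sum_distrib_left by (rule sum.swap)
      ultimately show ?thesis
        unfolding times_divide_eq_right sum_divide_distrib[symmetric] by (simp only:)
    qed
    ultimately show "(\<lambda>n. (\<Sum>k<n. of_bool (Q (cached w k) (push w k)) *
      (of_bool (hit w k) - pc / real N * real (cached w k))) / real n) \<longlonglongrightarrow> 0" by (simp only:)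
  qed
qed

text \<open>Elsewhere the battery may hoard energy, so the estimate is confined to starved slots,
  where less than \<open>Ep\<close> is left over.\<close>

lemma pushes_lower_bound_when_starved:
  assumes harvest: "\<forall>\<delta>>0. \<forall>\<^sub>F n in sequentially. real n * (Abar - \<delta>) \<le> (\<Sum>k<n. snd (w k))"
    and \<epsilon>: "0 < \<epsilon>"
  shows "\<forall>\<^sub>F n in sequentially. cached w n < T \<and> \<not> push w n \<longrightarrow>
     real n * (real T - \<epsilon>) \<le> (1 + 1 / (pc / real N)) * (\<Sum>k<n. of_bool (push w k))"
proof -
  define K where "K = 1 + 1 / (pc / real N)"
  have K: "0 < K" unfolding K_def using pc by (intro add_pos_nonneg) auto
  have T_le: "real T \<le> K / Ep * Abar"
    using T(2) pc Ep by (simp add: K_def field_simps)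
  \<comment> \<open>Scaled by \<open>K / Ep\<close>, this \<delta> costs
    \<open>\<epsilon> / 2\<close> per slot. The other half of \<epsilon> absorbs the unspent energy,
    which becomes the constant \<open>K\<close>, once \<open>n\<close> is at least
    \<open>2 * K / \<epsilon>\<close>.\<close>
  define \<delta> where "\<delta> = \<epsilon> / 2 * Ep / K"
  have \<delta>: "0 < \<delta>" using K Ep \<epsilon> by (simp add: \<delta>_def)
  have "\<forall>\<^sub>F n in sequentially. real n * (Abar - \<delta>) \<le> (\<Sum>k<n. snd (w k))" using harvest \<delta> by blast
  moreover have "\<forall>\<^sub>F n in sequentially. 2 * K / \<epsilon> \<le> real n"
    using eventually_ge_at_top[of "nat \<lceil>2 * K / \<epsilon>\<rceil>"] by eventually_elim linarith
  ultimately show ?thesis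
    unfolding K_def[symmetric]
  proof eventually_elim
    case (elim n)
    show ?case
    proof
      assume "cached w n < T \<and> \<not> push w n"
      then have "battery w n < Ep" by (auto simp: push_def potb_push_def)
      then have "real n * (Abar - \<delta>) - Ep \<le> Ep * (\<Sum>k<n. of_bool (push w k))"
        using elim(1) E0 by (simp add: battery_eq del: sum_of_bool_eq)
      then have "K / Ep * (real n * (Abar - \<delta>) - Ep) \<le> K / Ep * (Ep * (\<Sum>k<n. of_bool (push w k)))"
        using K Ep by (intro mult_left_mono) auto
      also have "\<dots> = K * (\<Sum>k<n. of_bool (push w k))" using Ep by simp
      also have "K / Ep * (real n * (Abar - \<delta>) - Ep) = real n * (K / Ep * Abar) - real n * (\<epsilon> / 2) - K"
        using Ep K by (simp add: \<delta>_def field_simps)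
      finally have "real n * (K / Ep * Abar) - real n * (\<epsilon> / 2) - K \<le> K * (\<Sum>k<n. of_bool (push w k))" .
      moreover have "real n * real T \<le> real n * (K / Ep * Abar)" using T_le by (intro mult_left_mono) auto
      moreover have "K \<le> real n * (\<epsilon> / 2)" using elim(2) \<epsilon> by (simp add: field_simps)
      ultimately show "real n * (real T - \<epsilon>) \<le> K * (\<Sum>k<n. of_bool (push w k))"
        by (simp add: right_diff_distrib del: sum_of_bool_eq)
    qed
  qed
qed

lemma AE_blocked_fraction:
  "AE w in slots.S. (\<lambda>n. blocked_fraction T Ep C0 E0 w n) \<longlonglongrightarrow> pu * (1 - (\<Sum>i=1..T. zipf N v i))"
proof -
  define late :: "slot \<Rightarrow> bool" where "late x = (\<exists>i>T. snd (snd (fst x)) = Some i)" for x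
  let ?p = "pu * (1 - (\<Sum>i=1..T. zipf N v i))"
  have requests: "AE w in slots.S. (\<lambda>n. (\<Sum>k<n. of_bool True * (of_bool (late (w k)) - ?p)) / real n) \<longlonglongrightarrow> 0"
  proof (rule slots.strong_law_predictable[where D = 1])
    have "(\<lambda>x. of_bool (late x) :: real) = (\<lambda>d. of_bool (\<exists>i>T. snd (snd d) = Some i)) \<circ> fst"
      by (auto simp: late_def)
    also have "\<dots> \<in> borel_measurable slot"
      by (rule measurable_comp[of _ _ "count_space UNIV"]) auto
    finally show "(\<lambda>x. of_bool (late x) :: real) \<in> borel_measurable slot" .
    show "(\<integral>x. (of_bool (late x) :: real) \<partial>slot) = ?p"
      unfolding late_def by (rule request_probability)
  qed auto
  show ?thesis
    using requests AE_hits harvest_lower_bound AE_slots_proper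
  proof eventually_elim
    case (elim w)
    define atyp where "atyp k = (T < cached w k \<or> cached w k < T \<and> \<not> push w k \<or> cached w k + 1 < T)" for k
    have atyp: "(\<lambda>n. (\<Sum>k<n. of_bool (atyp k)) / real n) \<longlonglongrightarrow> 0"
      unfolding atyp_def
    proof (rule atypical_slots_density_zero[where \<rho> = "pc / real N" and N = N and hit = "hit w"])
      fix k assume "hit w k"
      moreover have "1 \<le> fst (snd (fst (w k)))" using elim(4) by blast
      ultimately show "0 < cached w k" by (simp add: hit_def)
    next
      show "0 < pc / real N" "pc / real N * real N \<le> 1" using N pc by auto
    next
      fix \<epsilon> :: real assume "0 < \<epsilon>"
      then show "\<forall>\<^sub>F n in sequentially. cached w n < T \<and> \<not> push w n \<longrightarrow>
        real n * (real T - \<epsilon>) \<le> (1 + 1 / (pc / real N)) * (\<Sum>k<n. of_bool (push w k))"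
        by (rule pushes_lower_bound_when_starved[OF elim(3)])
    next
      show "(\<lambda>n. (\<Sum>k<n. of_bool (Q (cached w k) (push w k)) *
          (of_bool (hit w k) - pc / real N * real (cached w k))) / real n) \<longlonglongrightarrow> 0" for Q
        using elim(2) by blast
    qed (auto simp: cached_Suc push_cached_less cached_le T)
    have diff: "\<bar>of_bool (potb_blocked T Ep C0 E0 w k) - of_bool (late (w k))\<bar> \<le> (of_bool (atyp k) :: real)" for k
    proof (cases "atyp k")
      case False
      \<comment> \<open>In the second case the push itself serves rank \<open>T\<close>, so the
        blocked ranks are the same in both.\<close>
      then have "cached w k = T \<and> \<not> push w k \<or> cached w k + 1 = T \<and> push w k"
        using push_cached_less[of w k] by (auto simp: atyp_def)
      then have "potb_blocked T Ep C0 E0 w k \<longleftrightarrow> late (w k)"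
        by (auto simp: potb_blocked_eq late_def)
      then show ?thesis by simp
    qed auto
    have close: "(\<lambda>n. blocked_fraction T Ep C0 E0 w n - (\<Sum>k<n. of_bool (late (w k))) / real n) \<longlonglongrightarrow> 0"
    proof (rule Lim_null_comparison[OF always_eventually[OF allI] atyp])
      fix n
      have "\<bar>(\<Sum>k<n. of_bool (potb_blocked T Ep C0 E0 w k) - of_bool (late (w k)))\<bar> \<le> (\<Sum>k<n. of_bool (atyp k) :: real)"
        by (rule order_trans[OF sum_abs sum_mono]) (rule diff)
      then have "\<bar>(\<Sum>k<n. of_bool (potb_blocked T Ep C0 E0 w k) - of_bool (late (w k)))\<bar> / real n
          \<le> (\<Sum>k<n. of_bool (atyp k) :: real) / real n" by (rule divide_right_mono) simp
      then show "norm (blocked_fraction T Ep C0 E0 w n - (\<Sum>k<n. of_bool (late (w k))) / real n)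
          \<le> (\<Sum>k<n. of_bool (atyp k)) / real n"
        by (simp add: blocked_fraction_def of_bool_def sum_subtractf diff_divide_distrib[symmetric] abs_divide)
    qed
    have "(\<lambda>n. (\<Sum>k<n. of_bool (late (w k))) / real n - ?p) \<longlonglongrightarrow> 0"
    proof (rule Lim_transform_eventually[OF elim(1)])
      show "\<forall>\<^sub>F n in sequentially. (\<Sum>k<n. of_bool True * (of_bool (late (w k)) - ?p)) / real n
          = (\<Sum>k<n. of_bool (late (w k))) / real n - ?p"
        using eventually_gt_at_top[of 0]
        by eventually_elim (simp add: sum_subtractf diff_divide_distrib del: sum_of_bool_eq)
    qed
    from tendsto_add[OF close this]
    have "(\<lambda>n. blocked_fraction T Ep C0 E0 w n - ?p) \<longlonglongrightarrow> 0" by simp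
    then show ?case by (rule LIM_zero_cancel)
  qed
qed

end

theorem theorem1:
  fixes N :: nat and v pc pu Ep Abar E0 :: real and C0 :: nat and H :: "real measure"
  assumes "N \<ge> 1" and "v \<ge> 0"
    and "0 < pc" and "pc \<le> 1" and "0 \<le> pu" and "pu \<le> 1"
    and "Ep > 0"
    and "prob_space H" and "sets H = sets borel"
    and "AE a in H. a \<ge> 0" and "integrable H (\<lambda>a. a)" and "(\<integral>a. a \<partial>H) = Abar"
    and "Abar > 0"
    and "C0 \<le> N" and "E0 \<ge> 0"
  shows "AE w in slots_measure pc pu N v H.
           (\<lambda>n. blocked_fraction (C_thr_PO N pc Abar Ep) Ep C0 E0 w n)
             \<longlonglongrightarrow> pu * (1 - (\<Sum>i=1..C_thr_PO N pc Abar Ep. zipf N v i))"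
proof -
  \<comment> \<open>Nonnegativity matters because \<open>nat\<close> would raise a negative floor to
    0.\<close>
  have "0 \<le> (real N + pc) * Abar / (pc * Ep)" using assms by simp
  then have "real (C_thr_PO N pc Abar Ep) \<le> (real N + pc) * Abar / (pc * Ep)"
    unfolding C_thr_PO_def by linarith
  moreover have "C_thr_PO N pc Abar Ep \<le> N" by (simp add: C_thr_PO_def)
  ultimately interpret potb_process N v pc pu Abar H Ep E0 "C_thr_PO N pc Abar Ep" C0
    by (intro potb_process.intro slot_process.intro potb_process_axioms.intro assms)
  show ?thesis unfolding slots_measure_eq by (rule AE_blocked_fraction)
qed

end
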